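(* Let $F\colon\mathbb{R}^m\to\mathbb{R}$ be a permutation invariant averaging operator for which there exists $0<\kappa<1$ such that $F(x_1+c,x_2,\dots,x_m)\le F(x_1,\dots,x_m)+c\kappa$ for all $(x_1,\dots,x_m)\in\mathbb{R}^m$ and all $c>0$. Given $\varepsilon>0$ and $M>0$, there exists $\delta=\delta(\varepsilon,M,m)>0$ (depending on $\varepsilon$, $M$ and $m$) so that, if $f,g\colon[0,1]\to\mathbb{R}$ are continuous functions, $f=g$ in $[0,1]\setminus I$, and $\|f\|_\infty+\|g\|_\infty\le M$, where $I$ is a subinterval of $[0,1]$ with $|I|=\delta$, then $$|u(\emptyset)-v(\emptyset)|<\varepsilon,$$ where $u$ and $v$ are the solutions of the Dirichlet problem (DP) with boundary data $f$ and $g$ respectively.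
   Context: Fix an integer $m\ge 3$. The directed tree $\mathbb{T}_m$ with regular $m$-branching has as vertices the empty sequence $\emptyset$ and all finite sequences $(a_1,\dots,a_k)$, $k\ge1$, with $a_i\in\{0,\dots,m-1\}$. The successors of a vertex $x$ are the $m$ vertices $(x,0),\dots,(x,m-1)$ obtained by appending one coordinate. The boundary $\partial\mathbb{T}_m$ is the set of branches, i.e. infinite sequences $(a_1,a_2,\dots)$ in $\{0,\dots,m-1\}$; a branch is also written $\pi=(x_1,x_2,\dots)$ with $x_k=(a_1,\dots,a_k)$. Let $\psi\colon\partial\mathbb{T}_m\to[0,1]$, $\psi(\pi)=\sum_{k\ge1}a_km^{-k}$. For a function $g$ on $[0,1]$ write $g(\pi)=g(\psi(\pi))$. $|I|$ denotes the length of an interval $I$. An averaging operator is a continuous $F\colon\mathbb{R}^m\to\mathbb{R}$ such that: (i) $F(0,\dots,0)=0$ and $F(1,\dots,1)=1$; (ii) $F(tx_1,\dots,tx_m)=tF(x_1,\dots,x_m)$ for all $t\in\mathbb{R}$; (iii) $F(t+x_1,\dots,t+x_m)=t+F(x_1,\dots,x_m)$ for all $t\in\mathbb{R}$; (iv) $F(x_1,\dots,x_m)<\max\{x_1,\dots,x_m\}$ if not all $x_j$ are equal; (v) $F$ is nondecreasing in each variable. It is permutation invariant if $F(x_1,\dots,x_m)=F(x_{\tau(1)},\dots,x_{\tau(m)})$ for every permutation $\tau$ of $\{1,\dots,m\}$. A function $u\colon\mathbb{T}_m\to\mathbb{R}$ is $F$-harmonic if $u(x)=F(u(x,0),\dots,u(x,m-1))$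 for all $x\in\mathbb{T}_m$. A solution of (DP) with boundary data $f$ is an $F$-harmonic $u$ with $\lim_{k\to\infty}u(x_k)=f(\pi)$ for every $\pi=(x_1,x_2,\dots)\in\partial\mathbb{T}_m$ (for continuous $f$ it exists and is unique).
   Formalization: Here δ depends on κ as well as on ε, M and m (uniformly over all F with that κ), and δ ≤ 1; a δ independent of κ is impossible, e.g. for m = 3 and F = (1−t)·median + t·mean as t → 0. *)

theory Defs
  imports "HOL-Analysis.Analysis"
begin

text \<open>
  Points of \<open>\<real>\<^sup>m\<close> are functions on the index set \<open>{0,\<dots>,m-1}\<close>, represented as extensional functions
  on \<open>nat\<close>, so that each point has exactly one representative. The topology on this set induced by
  the product topology of \<open>nat \<Rightarrow> real\<close> is the usual one. The variable \<open>x\<^sub>j\<close> (\<open>1 \<le> j \<le> m\<close>) is \<open>x (j - 1)\<close>.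
\<close>

definition Rn :: "nat \<Rightarrow> (nat \<Rightarrow> real) set" where
  "Rn m = {..<m} \<rightarrow>\<^sub>E UNIV"

definition averaging_operator :: "nat \<Rightarrow> ((nat \<Rightarrow> real) \<Rightarrow> real) \<Rightarrow> bool" where
  "averaging_operator m F \<longleftrightarrow>
     continuous_on (Rn m) F \<and>
     F (\<lambda>j\<in>{..<m}. 0) = 0 \<and> F (\<lambda>j\<in>{..<m}. 1) = 1 \<and>
     (\<forall>t. \<forall>x\<in>Rn m. F (\<lambda>j\<in>{..<m}. t * x j) = t * F x) \<and>
     (\<forall>t. \<forall>x\<in>Rn m. F (\<lambda>j\<in>{..<m}. t + x j) = t + F x) \<and>
     (\<forall>x\<in>Rn m. \<not> (\<forall>i<m. \<forall>j<m. x i = x j) \<longrightarrow> F x < Max (x ` {..<m})) \<and>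
     (\<forall>x\<in>Rn m. \<forall>i<m. mono (\<lambda>s. F (x(i := s))))"

definition permutation_invariant :: "nat \<Rightarrow> ((nat \<Rightarrow> real) \<Rightarrow> real) \<Rightarrow> bool" where
  "permutation_invariant m F \<longleftrightarrow>
     (\<forall>\<tau>. \<tau> permutes {..<m} \<longrightarrow> (\<forall>x\<in>Rn m. F (\<lambda>j\<in>{..<m}. x (\<tau> j)) = F x))"

definition tree :: "nat \<Rightarrow> nat list set" where
  "tree m = lists {..<m}"

text \<open>A branch \<open>(a\<^sub>1, a\<^sub>2, \<dots>)\<close> is the function \<open>a\<close> with \<open>a\<^sub>k = a (k - 1)\<close>.\<close>

definition tree_boundary :: "nat \<Rightarrow> (nat \<Rightarrow> nat) set" where
  "tree_boundary m = (UNIV \<rightarrow> {..<m})"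

definition branch_vertex :: "(nat \<Rightarrow> nat) \<Rightarrow> nat \<Rightarrow> nat list" where
  "branch_vertex a k = map a [0..<k]"

definition boundary_map :: "nat \<Rightarrow> (nat \<Rightarrow> nat) \<Rightarrow> real" where
  "boundary_map m a = (\<Sum>k. real (a k) / real m ^ Suc k)"

definition F_harmonic :: "nat \<Rightarrow> ((nat \<Rightarrow> real) \<Rightarrow> real) \<Rightarrow> (nat list \<Rightarrow> real) \<Rightarrow> bool" where
  "F_harmonic m F u \<longleftrightarrow> (\<forall>x\<in>tree m. u x = F (\<lambda>j\<in>{..<m}. u (x @ [j])))"

definition DP_solution ::
    "nat \<Rightarrow> ((nat \<Rightarrow> real) \<Rightarrow> real) \<Rightarrow> (real \<Rightarrow> real) \<Rightarrow> (nat list \<Rightarrow> real) \<Rightarrow> bool" where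
  "DP_solution m F f u \<longleftrightarrow>
     F_harmonic m F u \<and>
     (\<forall>a\<in>tree_boundary m. (\<lambda>k. u (branch_vertex a k)) \<longlonglongrightarrow> f (boundary_map m a))"

text \<open>Only meaningful for functions that are bounded on \<open>[0,1]\<close>, such as continuous ones.\<close>

definition sup_norm :: "(real \<Rightarrow> real) \<Rightarrow> real" where
  "sup_norm f = (SUP x\<in>{0..1}. \<bar>f x\<bar>)"

end

theory Submission
  imports Defs
begin

text \<open>
  An averaging operator is nonexpansive for the maximum norm, and the extra hypothesis together with
  permutation invariance makes it contract by \<open>\<kappa>\<close> when only one coordinate is perturbed. Take
  \<open>\<delta> = m\<^sup>-\<^sup>n / 2\<close>: the interval \<open>I\<close> then meets at most two \<open>m\<close>-adic intervals of generation \<open>n\<close>, so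
  \<open>u\<close> and \<open>v\<close> agree at all but two vertices of level \<open>n\<close>, and there they differ by at most \<open>M\<close>.
  Going back to the root, the difference is contracted by \<open>\<kappa>\<close> at every level, except possibly at the
  one where the paths to the two exceptional vertices separate. Hence it is at most
  \<open>\<kappa>\<^sup>n\<^sup>-\<^sup>1 M\<close> at the root.
\<close>

section \<open>Order properties of averaging operators\<close>

lemma restrict_in_Rn [simp]: "restrict x {..<m} \<in> Rn m"
  by (simp add: Rn_def)

lemma Rn_eqI:
  assumes "x \<in> Rn m" "y \<in> Rn m" "\<And>j. j < m \<Longrightarrow> x j = y j"
  shows "x = y"
  using PiE_ext[of x "{..<m}" _ y] assms unfolding Rn_def by blast

text \<open>Monotonicity is assumed one variable at a time, so \<open>x\<close> is turned into
  \<open>y\<close> by replacing one coordinate after another; \<open>z i\<close> has the first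
  \<open>i\<close> replaced.\<close>

lemma averaging_operator_mono:
  assumes F: "averaging_operator m F" and x: "x \<in> Rn m" and y: "y \<in> Rn m"
    and le: "\<And>j. j < m \<Longrightarrow> x j \<le> y j"
  shows "F x \<le> F y"
proof -
  define z where "z i = (\<lambda>j\<in>{..<m}. if j < i then y j else x j)" for i
  have "F x \<le> F (z i)" if "i \<le> m" for i
    using that
  proof (induction i)
    case 0
    have "z 0 = x" by (rule Rn_eqI[OF _ x]) (auto simp: z_def)
    then show ?case by simp
  next
    case (Suc i)
    have "mono (\<lambda>s. F ((z i)(i := s)))"
      using F Suc.prems by (simp add: averaging_operator_def z_def)
    then have "F ((z i)(i := x i)) \<le> F ((z i)(i := y i))"
      using monoD[of _ "x i" "y i"] le[of i] Suc.prems by simp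
    moreover have "(z i)(i := x i) = z i" "(z i)(i := y i) = z (Suc i)"
      using Suc.prems by (auto simp: z_def fun_eq_iff)
    ultimately show ?case using Suc by simp
  qed
  moreover have "z m = y" by (rule Rn_eqI[OF _ y]) (auto simp: z_def)
  ultimately show ?thesis by force
qed

text \<open>Monotonicity compares \<open>x\<close> with the translate of \<open>y\<close>, and
  translation equivariance then pulls the constant out of \<open>F\<close>.\<close>

lemma averaging_operator_nonexpansive:
  assumes F: "averaging_operator m F" and x: "x \<in> Rn m" and y: "y \<in> Rn m"
    and le: "\<And>j. j < m \<Longrightarrow> x j \<le> c + y j"
  shows "F x \<le> c + F y"
proof -
  have "F x \<le> F (\<lambda>j\<in>{..<m}. c + y j)"
    using le by (intro averaging_operator_mono[OF F x]) auto
  also have "\<dots> = c + F y" using F y by (simp add: averaging_operator_def)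
  finally show ?thesis .
qed

text \<open>The hypothesis concerns coordinate 0 only; conjugation by the transposition of 0 and
  \<open>i\<close> carries it over to any coordinate. The case \<open>c = 0\<close> is included
  because the bounds fed in later are only known to be nonnegative.\<close>

lemma permutation_invariant_increment:
  assumes perm: "permutation_invariant m F"
    and incr: "\<forall>x\<in>Rn m. \<forall>c>0. F (x(0 := x 0 + c)) \<le> F x + c * \<kappa>"
    and y: "y \<in> Rn m" and "i < m" "c \<ge> 0"
  shows "F (y(i := y i + c)) \<le> F y + c * \<kappa>"
proof (cases "c = 0")
  case False
  define \<tau> where "\<tau> = Transposition.transpose 0 i"
  have \<tau>: "\<tau> permutes {..<m}" using \<open>i < m\<close> unfolding \<tau>_def by (intro permutes_swap_id) auto
  define z where "z = (\<lambda>j\<in>{..<m}. y (\<tau> j))"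
  have yi: "y(i := y i + c) \<in> Rn m" using y \<open>i < m\<close> by (auto simp: Rn_def PiE_iff extensional_def)
  have "F (\<lambda>j\<in>{..<m}. (y(i := y i + c)) (\<tau> j)) = F (y(i := y i + c))"
    using perm \<tau> yi unfolding permutation_invariant_def by blast
  moreover have "F z = F y"
    using perm \<tau> y unfolding permutation_invariant_def z_def by blast
  moreover have "(\<lambda>j\<in>{..<m}. (y(i := y i + c)) (\<tau> j)) = z(0 := z 0 + c)"
    using \<open>i < m\<close> by (auto simp: z_def \<tau>_def fun_eq_iff Transposition.transpose_def)
  moreover have "F (z(0 := z 0 + c)) \<le> F z + c * \<kappa>"
    using incr False \<open>c \<ge> 0\<close> unfolding z_def by (metis less_eq_real_def restrict_in_Rn)
  ultimately show ?thesis by simp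
qed simp

section \<open>Propagation of differences of harmonic functions towards the root\<close>

lemma F_harmonic_diff_le:
  assumes F: "averaging_operator m F" and u: "F_harmonic m F u" and v: "F_harmonic m F v"
    and x: "x \<in> tree m"
    and le: "\<And>j. j < m \<Longrightarrow> u (x @ [j]) - v (x @ [j]) \<le> c"
  shows "u x - v x \<le> c"
proof -
  have "F (\<lambda>j\<in>{..<m}. u (x @ [j])) \<le> c + F (\<lambda>j\<in>{..<m}. v (x @ [j]))"
    using le by (intro averaging_operator_nonexpansive[OF F]) (auto simp: algebra_simps)
  then show ?thesis using u v x by (simp add: F_harmonic_def)
qed

text \<open>Source of every factor \<open>\<kappa>\<close>: once the \<open>i\<close>-th child value
  of \<open>v\<close> is raised by \<open>c\<close>, the child values of \<open>v\<close> dominate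
  those of \<open>u\<close>, so monotonicity and the one-coordinate increment bound apply.\<close>

lemma F_harmonic_diff_le_single:
  assumes F: "averaging_operator m F" and perm: "permutation_invariant m F"
    and incr: "\<forall>x\<in>Rn m. \<forall>c>0. F (x(0 := x 0 + c)) \<le> F x + c * \<kappa>"
    and u: "F_harmonic m F u" and v: "F_harmonic m F v"
    and x: "x \<in> tree m" and "i < m" "c \<ge> 0"
    and le: "u (x @ [i]) - v (x @ [i]) \<le> c"
    and eq: "\<And>j. j < m \<Longrightarrow> j \<noteq> i \<Longrightarrow> u (x @ [j]) = v (x @ [j])"
  shows "u x - v x \<le> \<kappa> * c"
proof -
  define y where "y = (\<lambda>j\<in>{..<m}. v (x @ [j]))"
  have y: "y \<in> Rn m" by (simp add: y_def)
  have "F (\<lambda>j\<in>{..<m}. u (x @ [j])) \<le> F (y(i := y i + c))"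
    using le eq y \<open>i < m\<close>
    by (intro averaging_operator_mono[OF F]) (auto simp: y_def Rn_def PiE_iff extensional_def)
  also have "\<dots> \<le> F y + c * \<kappa>"
    by (rule permutation_invariant_increment[OF perm incr y]) fact+
  finally show ?thesis using u v x by (simp add: F_harmonic_def y_def algebra_simps)
qed

lemma append_in_tree [simp]: "x @ y \<in> tree m \<longleftrightarrow> x \<in> tree m \<and> y \<in> tree m"
  by (auto simp: tree_def)

lemma Cons_in_tree [simp]: "j # x \<in> tree m \<longleftrightarrow> j < m \<and> x \<in> tree m"
  by (auto simp: tree_def)

lemma Nil_in_tree [simp]: "[] \<in> tree m"
  by (simp add: tree_def)

text \<open>Serves to discard whole subtrees that contain no exceptional vertex.\<close>

lemma F_harmonic_eq_of_level:
  assumes F: "averaging_operator m F" and u: "F_harmonic m F u" and v: "F_harmonic m F v"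
    and "x \<in> tree m"
    and "\<And>y. y \<in> tree m \<Longrightarrow> length y = k \<Longrightarrow> u (x @ y) = v (x @ y)"
  shows "u x = v x"
  using assms(4,5)
proof (induction k arbitrary: x)
  case 0
  show ?case using "0.prems"(2)[of "[]"] by simp
next
  case (Suc k)
  have eq: "u (x @ [j]) = v (x @ [j])" if "j < m" for j
  proof (rule Suc.IH)
    show "u ((x @ [j]) @ y) = v ((x @ [j]) @ y)" if "y \<in> tree m" "length y = k" for y
      using Suc.prems(2)[of "j # y"] that \<open>j < m\<close> by simp
  qed (use Suc.prems that in simp)
  have "(\<lambda>j\<in>{..<m}. u (x @ [j])) = (\<lambda>j\<in>{..<m}. v (x @ [j]))"
    using eq by auto
  then show ?case using u v Suc.prems by (simp add: F_harmonic_def)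
qed

text \<open>The word \<open>p\<close> locates the exception relative to \<open>x\<close>. Only the
  child \<open>hd p\<close> can differ, and below it the exceptional word is \<open>tl p\<close>, so
  each of the \<open>k\<close> levels contributes one factor \<open>\<kappa>\<close>.\<close>

lemma F_harmonic_diff_le_one_exception:
  assumes F: "averaging_operator m F" and perm: "permutation_invariant m F"
    and incr: "\<forall>x\<in>Rn m. \<forall>c>0. F (x(0 := x 0 + c)) \<le> F x + c * \<kappa>"
    and "0 < \<kappa>" "0 \<le> M"
    and u: "F_harmonic m F u" and v: "F_harmonic m F v"
    and bound: "\<And>y. y \<in> tree m \<Longrightarrow> u y - v y \<le> M"
    and "x \<in> tree m"
    and "\<And>y. y \<in> tree m \<Longrightarrow> length y = k \<Longrightarrow> y \<noteq> p \<Longrightarrow> u (x @ y) = v (x @ y)"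
  shows "u x - v x \<le> \<kappa> ^ k * M"
  using assms(9,10)
proof (induction k arbitrary: x p)
  case 0
  then show ?case by (simp add: bound)
next
  case (Suc k)
  note x = Suc.prems(1) and agree = Suc.prems(2)
  have nonneg: "0 \<le> \<kappa> ^ k * M" using \<open>0 < \<kappa>\<close> \<open>0 \<le> M\<close> by simp
  \<comment> \<open>For \<open>p = []\<close> the value of \<open>hd p\<close> is arbitrary, but
    then no word \<open>j # y\<close> equals \<open>p\<close>.\<close>
  have eq: "u (x @ [j]) = v (x @ [j])" if "j < m" "j \<noteq> hd p" for j
  proof (rule F_harmonic_eq_of_level[OF F u v])
    show "u ((x @ [j]) @ y) = v ((x @ [j]) @ y)" if "y \<in> tree m" "length y = k" for y
      using that \<open>j < m\<close> \<open>j \<noteq> hd p\<close> agree[of "j # y"] by fastforce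
  qed (use x that in simp)
  show ?case
  proof (cases "hd p < m")
    case True
    have "u (x @ [hd p]) - v (x @ [hd p]) \<le> \<kappa> ^ k * M"
    proof (rule Suc.IH)
      show "u ((x @ [hd p]) @ y) = v ((x @ [hd p]) @ y)"
        if "y \<in> tree m" "length y = k" "y \<noteq> tl p" for y
      proof -
        have "hd p # y \<noteq> p" using that by (metis list.sel(3))
        then show ?thesis using that True agree[of "hd p # y"] by simp
      qed
    qed (use x True in simp)
    from F_harmonic_diff_le_single[OF F perm incr u v x True nonneg this eq]
    show ?thesis by simp
  next
    case False
    \<comment> \<open>Here \<open>hd p\<close> is not the index of a child, so \<open>eq\<close>
      covers every child.\<close>
    have "u x - v x \<le> 0"
      using eq False by (intro F_harmonic_diff_le[OF F u v x]) auto
    also have "\<dots> \<le> \<kappa> ^ Suc k * M" using \<open>0 < \<kappa>\<close> \<open>0 \<le> M\<close> by simp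
    finally show ?thesis .
  qed
qed

text \<open>The exponent is one less than the depth. As long as the two exceptional words share
  their first letter, each level contracts. Where they separate, every child has at most one
  exception below it, and nonexpansiveness passes the bound of the children on without a new
  factor.\<close>

lemma F_harmonic_diff_le_two_exceptions:
  assumes F: "averaging_operator m F" and perm: "permutation_invariant m F"
    and incr: "\<forall>x\<in>Rn m. \<forall>c>0. F (x(0 := x 0 + c)) \<le> F x + c * \<kappa>"
    and "0 < \<kappa>" "0 \<le> M"
    and u: "F_harmonic m F u" and v: "F_harmonic m F v"
    and bound: "\<And>y. y \<in> tree m \<Longrightarrow> u y - v y \<le> M"
    and "x \<in> tree m"
    and "\<And>y. y \<in> tree m \<Longrightarrow> length y = Suc k \<Longrightarrow> y \<noteq> p \<Longrightarrow> y \<noteq> q \<Longrightarrow> u (x @ y) = v (x @ y)"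
  shows "u x - v x \<le> \<kappa> ^ k * M"
  using assms(9,10)
proof (induction k arbitrary: x p q)
  case 0
  then show ?case by (simp add: bound)
next
  case (Suc k)
  note x = Suc.prems(1) and agree = Suc.prems(2)
  have nonneg: "0 \<le> \<kappa> ^ k * M" using \<open>0 < \<kappa>\<close> \<open>0 \<le> M\<close> by simp
  have eq: "u (x @ [j]) = v (x @ [j])" if "j < m" "j \<noteq> hd p" "j \<noteq> hd q" for j
  proof (rule F_harmonic_eq_of_level[OF F u v])
    show "u ((x @ [j]) @ y) = v ((x @ [j]) @ y)" if "y \<in> tree m" "length y = Suc k" for y
      using that \<open>j < m\<close> \<open>j \<noteq> hd p\<close> \<open>j \<noteq> hd q\<close> agree[of "j # y"] by fastforce
  qed (use x that in simp)
  show ?case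
  proof (cases "hd p < m \<and> hd p = hd q")
    case True
    then have hp: "hd p < m" by simp
    have "u (x @ [hd p]) - v (x @ [hd p]) \<le> \<kappa> ^ k * M"
    proof (rule Suc.IH)
      show "u ((x @ [hd p]) @ y) = v ((x @ [hd p]) @ y)"
        if "y \<in> tree m" "length y = Suc k" "y \<noteq> tl p" "y \<noteq> tl q" for y
      proof -
        have "hd p # y \<noteq> p" "hd p # y \<noteq> q" using that by (metis list.sel(3))+
        then show ?thesis using that hp agree[of "hd p # y"] by simp
      qed
    qed (use x hp in simp)
    moreover have "u (x @ [j]) = v (x @ [j])" if "j < m" "j \<noteq> hd p" for j
      by (rule eq) (use True that in auto)
    ultimately have "u x - v x \<le> \<kappa> * (\<kappa> ^ k * M)"
      by (rule F_harmonic_diff_le_single[OF F perm incr u v x hp nonneg])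
    then show ?thesis by simp
  next
    case False
    have "u (x @ [j]) - v (x @ [j]) \<le> \<kappa> ^ Suc k * M" if j: "j < m" for j
    proof (rule F_harmonic_diff_le_one_exception[OF F perm incr \<open>0 < \<kappa>\<close> \<open>0 \<le> M\<close> u v bound])
      \<comment> \<open>If \<open>j\<close> is neither head, no word \<open>j # y\<close> is
        exceptional and the choice of \<open>tl q\<close> is immaterial.\<close>
      show "u ((x @ [j]) @ y) = v ((x @ [j]) @ y)"
        if "y \<in> tree m" "length y = Suc k" "y \<noteq> (if j = hd p then tl p else tl q)" for y
      proof -
        have "j # y \<noteq> p" "j # y \<noteq> q" using that(3) j False by (metis list.sel(1,3))+
        then show ?thesis using that j agree[of "j # y"] by simp
      qed
    qed (use x j in auto)
    then show ?thesis by (rule F_harmonic_diff_le[OF F u v x])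
  qed
qed

section \<open>Comparison of solutions with their boundary data\<close>

text \<open>A maximum principle with a witness: starting from \<open>x\<close>, descend each time to
  a child where \<open>u - v\<close> is at least as large; a child maximizing it qualifies. The
  limit along the resulting branch is the difference of the boundary data.\<close>

lemma DP_solution_diff_le:
  assumes F: "averaging_operator m F" and "m > 0"
    and u: "DP_solution m F f u" and v: "DP_solution m F g v" and x: "x \<in> tree m"
  obtains a where "a \<in> tree_boundary m" "branch_vertex a (length x) = x"
    "u x - v x \<le> f (boundary_map m a) - g (boundary_map m a)"
proof -
  have harm: "F_harmonic m F u" "F_harmonic m F v" using u v by (simp_all add: DP_solution_def)
  have step: "\<forall>y\<in>tree m. \<exists>j. j < m \<and> u y - v y \<le> u (y @ [j]) - v (y @ [j])"
  proof
    fix y assume y: "y \<in> tree m"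
    define d where "d j = u (y @ [j]) - v (y @ [j])" for j
    have "Max (d ` {..<m}) \<in> d ` {..<m}" using \<open>m > 0\<close> by (intro Max_in) auto
    then obtain j where j: "j < m" "Max (d ` {..<m}) = d j" by auto
    have "u y - v y \<le> Max (d ` {..<m})"
    proof (rule F_harmonic_diff_le[OF F harm y])
      show "u (y @ [i]) - v (y @ [i]) \<le> Max (d ` {..<m})" if "i < m" for i
        unfolding d_def[symmetric] using that by simp
    qed
    then show "\<exists>j. j < m \<and> u y - v y \<le> u (y @ [j]) - v (y @ [j])" using j unfolding d_def by auto
  qed
  then obtain s where s: "\<And>y. y \<in> tree m \<Longrightarrow> s y < m"
      "\<And>y. y \<in> tree m \<Longrightarrow> u y - v y \<le> u (y @ [s y]) - v (y @ [s y])"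
    using bchoice[OF step] by blast
  define w where "w = rec_nat x (\<lambda>_ y. y @ [s y])"
  have w_simps [simp]: "w 0 = x" "w (Suc k) = w k @ [s (w k)]" for k
    by (simp_all add: w_def)
  have w_tree: "w k \<in> tree m" for k
    by (induction k) (auto simp: x s)
  \<comment> \<open>The branch spells \<open>x\<close> first and then the chosen letters, so that it
    passes through every \<open>w k\<close>.\<close>
  define a where "a k = (if k < length x then x ! k else s (w (k - length x)))" for k
  have bv: "branch_vertex a (length x + k) = w k" for k
  proof (induction k)
    case 0
    show ?case by (auto simp: branch_vertex_def a_def intro: nth_equalityI)
  qed (auto simp: branch_vertex_def a_def)
  have a: "a \<in> tree_boundary m"
    using x s w_tree by (auto simp: tree_boundary_def a_def tree_def in_lists_conv_set)
  have mono: "u x - v x \<le> u (w k) - v (w k)" for k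
  proof (induction k)
    case (Suc k)
    then show ?case using s(2)[OF w_tree[of k]] by simp
  qed simp
  have "(\<lambda>k. u (branch_vertex a k) - v (branch_vertex a k))
      \<longlonglongrightarrow> f (boundary_map m a) - g (boundary_map m a)"
    using u v a unfolding DP_solution_def by (intro tendsto_diff) auto
  from LIMSEQ_ignore_initial_segment[OF this, of "length x"]
  have "(\<lambda>k. u (w k) - v (w k)) \<longlonglongrightarrow> f (boundary_map m a) - g (boundary_map m a)"
    by (simp add: add.commute[of _ "length x"] bv)
  then have "u x - v x \<le> f (boundary_map m a) - g (boundary_map m a)"
    by (rule LIMSEQ_le_const) (use mono in auto)
  with a bv[of 0] show ?thesis using that by simp
qed

section \<open>Base \<open>m\<close> expansions and the boundary map\<close>

text \<open>Horner evaluation, leading digit first: the index of the \<open>m\<close>-adic interval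
  of generation \<open>length y\<close> that belongs to the vertex \<open>y\<close>.\<close>

definition digits_value :: "nat \<Rightarrow> nat list \<Rightarrow> nat" where
  "digits_value m y = foldl (\<lambda>s j. m * s + j) 0 y"

text \<open>The remainder modulo \<open>m\<close> recovers the last digit. Equal lengths rule out
  padding by leading zeros.\<close>

lemma inj_digits_value:
  assumes "x \<in> tree m" "y \<in> tree m" "length x = length y" "digits_value m x = digits_value m y"
  shows "x = y"
  using assms
proof (induction x arbitrary: y rule: rev_induct)
  case (snoc j x)
  obtain z i where y: "y = z @ [i]" using snoc.prems by (cases y rule: rev_cases) auto
  have lt: "j < m" "i < m" using snoc.prems y by auto
  have eq: "m * digits_value m x + j = m * digits_value m z + i"
    using snoc.prems y by (simp add: digits_value_def)
  then have "(m * digits_value m x + j) mod m = (m * digits_value m z + i) mod m" by simp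
  then have ij: "j = i" using lt by simp
  then have "digits_value m x = digits_value m z" using eq lt by simp
  then show ?case using snoc y ij by simp
qed simp

text \<open>Comparison with the branch all of whose digits are \<open>m - 1\<close>, whose geometric
  series sums to 1.\<close>

lemma boundary_map_summable_le:
  assumes a: "a \<in> tree_boundary m" and m: "m \<ge> 2"
  shows boundary_map_summable: "summable (\<lambda>k. real (a k) / real m ^ Suc k)"
    and boundary_map_nonneg: "0 \<le> boundary_map m a"
    and boundary_map_le_1: "boundary_map m a \<le> 1"
proof -
  have "(\<lambda>k. (1 / real m) ^ k) sums (1 / (1 - 1 / real m))"
    using m by (intro geometric_sums) auto
  from sums_mult[OF this, of "(real m - 1) / real m"]
  have geo: "(\<lambda>k. (real m - 1) / real m ^ Suc k) sums 1"
    using m by (simp add: field_simps power_divide)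
  have le: "real (a k) / real m ^ Suc k \<le> (real m - 1) / real m ^ Suc k" for k
  proof -
    have "a k < m" using a by (auto simp: tree_boundary_def)
    then show ?thesis using m by (intro divide_right_mono) auto
  qed
  show sm: "summable (\<lambda>k. real (a k) / real m ^ Suc k)"
    by (rule summable_comparison_test'[OF sums_summable[OF geo], of 0]) (use le in auto)
  show "0 \<le> boundary_map m a"
    unfolding boundary_map_def by (rule suminf_nonneg[OF sm]) auto
  show "boundary_map m a \<le> 1"
    using suminf_le[OF le sm sums_summable[OF geo]] sums_unique[OF geo]
    unfolding boundary_map_def by simp
qed

text \<open>Self-similarity: the tail after \<open>n\<close> letters is again a branch, and its
  boundary point is the position inside the \<open>m\<close>-adic interval, rescaled to unit
  length.\<close>

lemma boundary_map_split:
  assumes a: "a \<in> tree_boundary m" and m: "m \<ge> 2"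
  shows "boundary_map m a =
    (digits_value m (branch_vertex a n) + boundary_map m (\<lambda>k. a (k + n))) / real m ^ n"
proof (induction n)
  case 0
  show ?case by (simp add: digits_value_def branch_vertex_def)
next
  case (Suc n)
  define b where "b = (\<lambda>k. a (k + n))"
  have b: "b \<in> tree_boundary m" using a by (auto simp: b_def tree_boundary_def)
  have b': "(\<lambda>k. b (Suc k)) \<in> tree_boundary m" using b by (auto simp: tree_boundary_def)
  have "boundary_map m b = real (b 0) / m + (\<Sum>k. (real (b (Suc k)) / real m ^ Suc k) / m)"
    unfolding boundary_map_def using suminf_split_head[OF boundary_map_summable[OF b m]]
    by (simp add: mult.commute)
  also have "\<dots> = real (b 0) / m + boundary_map m (\<lambda>k. b (Suc k)) / m"
    unfolding boundary_map_def
    by (subst suminf_divide[OF boundary_map_summable[OF b' m]]) simp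
  finally have "boundary_map m b = (b 0 + boundary_map m (\<lambda>k. b (Suc k))) / m"
    by (simp add: add_divide_distrib)
  then have "real m * boundary_map m b = a n + boundary_map m (\<lambda>k. a (k + Suc n))"
    using m by (simp add: b_def)
  then have "(digits_value m (branch_vertex a n) + boundary_map m b) * m =
      digits_value m (branch_vertex a (Suc n)) + boundary_map m (\<lambda>k. a (k + Suc n))"
    by (simp add: branch_vertex_def digits_value_def algebra_simps)
  then show ?case
    using m unfolding Suc b_def[symmetric] by (simp add: divide_simps mult_ac)
qed

lemma boundary_map_bounds:
  assumes a: "a \<in> tree_boundary m" and m: "m \<ge> 2"
  shows "digits_value m (branch_vertex a n) \<le> boundary_map m a * real m ^ n"
    and "boundary_map m a * real m ^ n \<le> digits_value m (branch_vertex a n) + 1"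
proof -
  have "(\<lambda>k. a (k + n)) \<in> tree_boundary m" using a by (auto simp: tree_boundary_def)
  from boundary_map_nonneg[OF this m] boundary_map_le_1[OF this m]
  show "digits_value m (branch_vertex a n) \<le> boundary_map m a * real m ^ n"
    "boundary_map m a * real m ^ n \<le> digits_value m (branch_vertex a n) + 1"
    using m by (simp_all add: boundary_map_split[OF a m, of n])
qed

section \<open>Short intervals and exceptional vertices\<close>

text \<open>The segment between two points of an interval lies in it. Boundedness keeps the measure
  finite; \<open>measure\<close> would turn an infinite one into 0.\<close>

lemma interval_dist_le_measure:
  fixes I :: "real set"
  assumes I: "is_interval I" "bounded I" and s: "s \<in> I" and t: "t \<in> I"
  shows "\<bar>s - t\<bar> \<le> measure lborel I"
proof -
  have meas: "I \<in> sets lborel"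
    using I(1) by (simp add: real_interval_borel_measurable)
  have sub: "{min s t..max s t} \<subseteq> I"
  proof
    fix r assume "r \<in> {min s t..max s t}"
    then consider "s \<le> r" "r \<le> t" | "t \<le> r" "r \<le> s" by fastforce
    then show "r \<in> I" by cases (use mem_is_interval_1_I[OF I(1)] s t in blast)+
  qed
  have "\<bar>s - t\<bar> = measure lborel {min s t..max s t}" by (simp add: min_def max_def)
  also have "\<dots> \<le> measure lborel I"
  proof (rule measure_mono_fmeasurable[OF sub])
    show "I \<in> fmeasurable lborel"
      using emeasure_bounded_finite[OF I(2)] meas by (auto simp: fmeasurable_def)
  qed simp
  finally show ?thesis .
qed

text \<open>Points of \<open>I\<close> are less than one \<open>m\<close>-adic length apart, so the
  indices of any two vertices in \<open>B\<close> differ by at most 1. All indices are therefore the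
  minimal one or its successor, and the index determines the vertex.\<close>

lemma two_exceptional_vertices:
  assumes m: "m \<ge> 2" and I: "is_interval I" "bounded I" "measure lborel I < 1 / real m ^ n"
    and B: "\<And>x. x \<in> B \<Longrightarrow> x \<in> tree m \<and> length x = n \<and>
      (\<exists>a\<in>tree_boundary m. branch_vertex a n = x \<and> boundary_map m a \<in> I)"
  obtains p q where "B \<subseteq> {p, q}"
proof (cases "B = {}")
  case False
  define N where "N = digits_value m"
  have close: "N x \<le> N y + 1" if "x \<in> B" "y \<in> B" for x y
  proof -
    obtain a where a: "a \<in> tree_boundary m" "branch_vertex a n = x" "boundary_map m a \<in> I"
      using B \<open>x \<in> B\<close> by blast
    obtain b where b: "b \<in> tree_boundary m" "branch_vertex b n = y" "boundary_map m b \<in> I"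
      using B \<open>y \<in> B\<close> by blast
    have "boundary_map m a - boundary_map m b < 1 / real m ^ n"
      using interval_dist_le_measure[OF I(1,2) a(3) b(3)] I(3) by linarith
    then have "boundary_map m a * real m ^ n < boundary_map m b * real m ^ n + 1"
      using m by (simp add: field_simps)
    \<comment> \<open>Passing from points to indices costs at most 1, so the gap stays strictly
      below 2; for natural numbers this means at most 1.\<close>
    with boundary_map_bounds(1)[OF a(1) m, of n] boundary_map_bounds(2)[OF b(1) m, of n]
    have "real (N x) < real (N y) + 2" unfolding a(2) b(2) N_def by linarith
    then show ?thesis by linarith
  qed
  have inj: "x = y" if "x \<in> B" "y \<in> B" "N x = N y" for x y
    using that B[of x] B[of y] inj_digits_value[of x m y] by (auto simp: N_def)
  define P where "P = (\<lambda>y. y \<in> B)"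
  obtain b where "P b" using False by (auto simp: P_def)
  define p where "p = arg_min N P"
  have p: "p \<in> B" "\<And>y. y \<in> B \<Longrightarrow> N p \<le> N y"
    using arg_min_natI[of P b N] arg_min_nat_le[of P _ N] \<open>P b\<close> by (simp_all add: p_def P_def)
  have N: "N x = N p \<or> N x = N p + 1" if "x \<in> B" for x
    using p(2)[OF that] close[OF that p(1)] by linarith
  show ?thesis
  proof (cases "\<exists>q\<in>B. N q = N p + 1")
    case True
    then obtain q where q: "q \<in> B" "N q = N p + 1" by blast
    have "x = p \<or> x = q" if "x \<in> B" for x
      using N[OF that] inj[OF that p(1)] inj[OF that q(1)] q(2) by argo
    then show ?thesis using that by blast
  next
    case no: False
    have "x = p" if "x \<in> B" for x
      using N[OF that] inj[OF that p(1)] no that by blast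
    then show ?thesis using that by blast
  qed
next
  case True
  then show ?thesis using that by blast
qed

section \<open>The estimate at the root and the choice of \<open>\<delta>\<close>\<close>

lemma abs_le_sup_norm:
  assumes "continuous_on {0..1} f" "x \<in> {0..1}"
  shows "\<bar>f x\<bar> \<le> sup_norm f"
  unfolding sup_norm_def
proof (rule cSUP_upper[OF assms(2)])
  have "continuous_on {0..1} (\<lambda>x. \<bar>f x\<bar>)" using assms(1) by (intro continuous_intros)
  then show "bdd_above ((\<lambda>x. \<bar>f x\<bar>) ` {0..1})"
    by (intro bounded_imp_bdd_above compact_imp_bounded compact_continuous_image) auto
qed

text \<open>One-sided, to be applied a second time with the two solutions exchanged. Level
  \<open>Suc n\<close> is inspected because one factor may be lost where the two exceptional paths
  separate.\<close>

lemma DP_solution_root_diff_le: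
  assumes m: "m \<ge> 2" and "0 < \<kappa>" "0 \<le> M"
    and F: "averaging_operator m F" and perm: "permutation_invariant m F"
    and incr: "\<forall>x\<in>Rn m. \<forall>c>0. F (x(0 := x 0 + c)) \<le> F x + c * \<kappa>"
    and I: "is_interval I" "bounded I" "measure lborel I < 1 / real m ^ Suc n"
    and agree: "\<forall>x\<in>{0..1} - I. f x = g x"
    and bound: "\<forall>x\<in>{0..1}. \<bar>f x - g x\<bar> \<le> M"
    and u: "DP_solution m F f u" and v: "DP_solution m F g v"
  shows "u [] - v [] \<le> \<kappa> ^ n * M"
proof -
  have m0: "m > 0" using m by simp
  have in01: "boundary_map m a \<in> {0..1}" if "a \<in> tree_boundary m" for a
    using boundary_map_nonneg[OF that m] boundary_map_le_1[OF that m] by simp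
  have le_M: "u x - v x \<le> M" if "x \<in> tree m" for x
    using DP_solution_diff_le[OF F m0 u v that] bound in01 by (smt (verit))
  define B where "B = {x \<in> tree m. length x = Suc n \<and> u x \<noteq> v x}"
  \<comment> \<open>The branch given by the maximum principle has different boundary values of
    \<open>f\<close> and \<open>g\<close>, so its boundary point must lie in \<open>I\<close>. A
    negative difference is treated by exchanging the solutions.\<close>
  have meets: "\<exists>a\<in>tree_boundary m. branch_vertex a (length x) = x \<and> boundary_map m a \<in> I"
    if "x \<in> tree m" "u x \<noteq> v x" for x
  proof (cases "u x > v x")
    case True
    obtain a where "a \<in> tree_boundary m" "branch_vertex a (length x) = x"
      "u x - v x \<le> f (boundary_map m a) - g (boundary_map m a)"
      using DP_solution_diff_le[OF F m0 u v \<open>x \<in> tree m\<close>] .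
    then show ?thesis using True agree in01[of a] by force
  next
    case False
    obtain a where "a \<in> tree_boundary m" "branch_vertex a (length x) = x"
      "v x - u x \<le> g (boundary_map m a) - f (boundary_map m a)"
      using DP_solution_diff_le[OF F m0 v u \<open>x \<in> tree m\<close>] .
    then show ?thesis using False that(2) agree in01[of a] by force
  qed
  obtain p q where pq: "B \<subseteq> {p, q}"
    by (rule two_exceptional_vertices[OF m I, of B]) (use meets in \<open>force simp: B_def\<close>)
  show ?thesis
    using u v pq le_M unfolding DP_solution_def B_def
    by (intro F_harmonic_diff_le_two_exceptions[OF F perm incr \<open>0 < \<kappa>\<close> \<open>0 \<le> M\<close>, of u v "[]" n p q]) auto
qed

theorem corollary1p3:
  fixes m :: nat and \<kappa> \<epsilon> M :: real
  assumes "m \<ge> 3" and "0 < \<kappa>" and "\<kappa> < 1" and "\<epsilon> > 0" and "M > 0"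
  shows "\<exists>\<delta>>0. \<delta> \<le> 1 \<and>
    (\<forall>F :: (nat \<Rightarrow> real) \<Rightarrow> real.
      averaging_operator m F \<and> permutation_invariant m F \<and>
      (\<forall>x\<in>Rn m. \<forall>c>0. F (x(0 := x 0 + c)) \<le> F x + c * \<kappa>) \<longrightarrow>
      (\<forall>(f :: real \<Rightarrow> real) (g :: real \<Rightarrow> real) (I :: real set) (u :: nat list \<Rightarrow> real) (v :: nat list \<Rightarrow> real).
        continuous_on {0..1} f \<and> continuous_on {0..1} g \<and>
        is_interval I \<and> I \<subseteq> {0..1} \<and> measure lborel I = \<delta> \<and>
        (\<forall>x\<in>{0..1} - I. f x = g x) \<and>
        sup_norm f + sup_norm g \<le> M \<and>
        DP_solution m F f u \<and> DP_solution m F g v \<longrightarrow>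
        \<bar>u [] - v []\<bar> < \<epsilon>))"
proof -
  \<comment> \<open>This \<open>n\<close> is chosen from \<open>\<kappa>\<close>,
    \<open>\<epsilon>\<close> and \<open>M\<close> alone, which makes \<open>\<delta>\<close>
    uniform in \<open>F\<close> and in the boundary data.\<close>
  from real_arch_pow_inv[of "\<epsilon> / M" \<kappa>] assms obtain n where "\<kappa> ^ n < \<epsilon> / M" by auto
  then have n: "\<kappa> ^ n * M < \<epsilon>" using \<open>M > 0\<close> by (simp add: field_simps)
  \<comment> \<open>The length of an \<open>m\<close>-adic interval of generation
    \<open>Suc n\<close>. Taking half of it gives the strict inequality needed to bound the index
    gap, and \<open>h \<le> 1\<close> ensures that intervals of length \<open>\<delta>\<close> fit
    into \<open>{0..1}\<close>.\<close>
  define h where "h = 1 / real m ^ Suc n"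
  define \<delta> where "\<delta> = h / 2"
  have "0 < h" using \<open>m \<ge> 3\<close> by (simp add: h_def)
  have "1 \<le> real m ^ Suc n" using \<open>m \<ge> 3\<close> by (intro one_le_power) simp
  then have "h \<le> 1" using frac_le[of 1 1 1 "real m ^ Suc n"] by (simp add: h_def del: power_Suc)
  with \<open>0 < h\<close> have \<delta>: "0 < \<delta>" "\<delta> \<le> 1" "\<delta> < h"
    by (simp_all add: \<delta>_def)
  show ?thesis
  proof (intro exI[of _ \<delta>] conjI allI impI \<delta>; elim conjE)
    fix F :: "(nat \<Rightarrow> real) \<Rightarrow> real" and f g :: "real \<Rightarrow> real" and I :: "real set"
      and u v :: "nat list \<Rightarrow> real"
    assume F: "averaging_operator m F" "permutation_invariant m F"
        "\<forall>x\<in>Rn m. \<forall>c>0. F (x(0 := x 0 + c)) \<le> F x + c * \<kappa>"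
      and cont: "continuous_on {0..1} f" "continuous_on {0..1} g"
      and I: "is_interval I" "I \<subseteq> {0..1}" "measure lborel I = \<delta>"
      and agree: "\<forall>x\<in>{0..1} - I. f x = g x"
      and norm: "sup_norm f + sup_norm g \<le> M"
      and uv: "DP_solution m F f u" "DP_solution m F g v"
    have m: "m \<ge> 2" and M: "0 \<le> M" using assms by auto
    have bI: "bounded I" by (rule bounded_subset[OF bounded_closed_interval I(2)])
    have mI: "measure lborel I < 1 / real m ^ Suc n" using I(3) \<delta>(3) unfolding h_def by simp
    have bound: "\<bar>f x - g x\<bar> \<le> M" if "x \<in> {0..1}" for x
      using abs_le_sup_norm[OF cont(1) that] abs_le_sup_norm[OF cont(2) that] norm by linarith
    note root = DP_solution_root_diff_le[OF m \<open>0 < \<kappa>\<close> M F I(1) bI mI]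
    have "u [] - v [] \<le> \<kappa> ^ n * M"
      by (rule root[of f g]) (use agree bound uv in auto)
    moreover have "v [] - u [] \<le> \<kappa> ^ n * M"
      by (rule root[of g f]) (use agree bound uv in \<open>auto simp: abs_minus_commute\<close>)
    ultimately show "\<bar>u [] - v []\<bar> < \<epsilon>" using n by linarith
  qed
qed

end
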